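(* Let $w$ be an arbitrary word in the alphabet $\{x,D\}$ with $m$ $x$'s, and let $x^awD^b$ be its associated Dyck word. For $1\le i\le m+a$ let $a_i$ be the height of the $i$-th $x$ in $x^awD^b$. Then for all integers $k\ge 0$, $$S_w(k) = \frac{1}{(k+b)!}\sum_{\ell=0}^{k+b} (-1)^\ell{k+b \choose \ell} \prod_{i=1}^{m+a} (k+b-\ell-a_i).$$
   Context: Stirling numbers of a word. View $x$ as the operator of multiplication by the variable $x$ and $D$ as differentiation with respect to $x$, acting on infinitely differentiable functions (say on $(0,\infty)$); a word in $\{x,D\}$ is read as the composition of these operators (so $Dx = xD+1$). For every word $w$ with $m$ $x$'s and $n$ $D$'s there is a unique sequence of integers $(S_w(k))_{k\ge 0}$ (only finitely many nonzero) with $$w = x^{m-n}\sum_{k\ge 0} S_w(k)\, x^k D^k .$$ Dyck words. A word in $\{x,D\}$ is a Dyck word if it has the same number of $x$'s as $D$'s and every initial segment (reading left to right) has at least as many $x$'s as $D$'s. Associated Dyck word. For a word $w$ in $\{x,D\}$, let $a=a(w)$ be the least non-negative integer such that all initial segments of $x^a w$ have at least as many $x$'s as $D$'s, and let $b=b(w)$ be the unique non-negative integer such that $x^a w D^b$ is a Dyck word. Then $x^awD^b$ is the Dyck word associated with $w$. Height. The height $a_i$ of the $i$-th $x$ (counted from the left) in $x^awD^b$ is the number of $x$'s minus the number of $D$'s in the initial segment of $x^awD^b$ that ends immediately before the $i$-th $x$. *)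

theory Defs
  imports "HOL-Analysis.Analysis" "HOL-Library.Sublist"
begin

datatype letter = LX | LD

type_synonym word = "letter list"

definition num_x :: "word \<Rightarrow> nat" where
  "num_x w = count_list w LX"

definition num_d :: "word \<Rightarrow> nat" where
  "num_d w = count_list w LD"

text \<open>Functions on the positive half-line are represented by total functions on the reals whose
  values at non-positive arguments are ignored.\<close>

definition smooth_pos :: "(real \<Rightarrow> real) \<Rightarrow> bool" where
  "smooth_pos f \<longleftrightarrow> (\<forall>n. \<forall>x>0. (deriv ^^ n) f field_differentiable (at x))"

text \<open>The leftmost letter is the outermost operator.\<close>

fun word_op :: "word \<Rightarrow> (real \<Rightarrow> real) \<Rightarrow> (real \<Rightarrow> real)" where
  "word_op [] f = f"
| "word_op (LX # w) f = (\<lambda>x. x * word_op w f x)"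
| "word_op (LD # w) f = deriv (word_op w f)"

text \<open>The exponent of the prefactor may be negative, hence the integer power.\<close>

definition normal_ordering :: "word \<Rightarrow> (nat \<Rightarrow> int) \<Rightarrow> bool" where
  "normal_ordering w S \<longleftrightarrow> finite {k. S k \<noteq> 0} \<and>
     (\<forall>f. smooth_pos f \<longrightarrow> (\<forall>x>0. word_op w f x =
        x powi (int (num_x w) - int (num_d w)) *
          (\<Sum>k | S k \<noteq> 0. of_int (S k) * x ^ k * (deriv ^^ k) f x)))"

definition word_stirling :: "word \<Rightarrow> nat \<Rightarrow> int" where
  "word_stirling w = (THE S. normal_ordering w S)"

definition prefix_dominant :: "word \<Rightarrow> bool" where
  "prefix_dominant w \<longleftrightarrow> (\<forall>u. prefix u w \<longrightarrow> num_d u \<le> num_x u)"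

definition dyck_word :: "word \<Rightarrow> bool" where
  "dyck_word w \<longleftrightarrow> num_x w = num_d w \<and> prefix_dominant w"

definition dyck_a :: "word \<Rightarrow> nat" where
  "dyck_a w = (LEAST a. prefix_dominant (replicate a LX @ w))"

definition dyck_b :: "word \<Rightarrow> nat" where
  "dyck_b w = (THE b. dyck_word (replicate (dyck_a w) LX @ w @ replicate b LD))"

definition assoc_dyck :: "word \<Rightarrow> word" where
  "assoc_dyck w = replicate (dyck_a w) LX @ w @ replicate (dyck_b w) LD"

text \<open>The occurrences of \<open>LX\<close> are numbered from 1, whereas positions in a list start at 0.\<close>

definition x_position :: "word \<Rightarrow> nat \<Rightarrow> nat" where
  "x_position v i = filter (\<lambda>p. v ! p = LX) [0..<length v] ! (i - 1)"

definition x_height :: "word \<Rightarrow> nat \<Rightarrow> int" where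
  "x_height v i = int (num_x (take (x_position v i) v)) - int (num_d (take (x_position v i) v))"

end

theory Submission
  imports Defs
begin

text \<open>
  Both \<open>S\<^sub>w(k)\<close> and the product over the heights are read off from the action of words on
  monomials. Since \<open>x\<^sup>k D\<^sup>k\<close> multiplies \<open>x\<^sup>t\<close> by the falling factorial \<open>k! (t choose k)\<close>, a word
  \<open>v\<close> multiplies \<open>x\<^sup>t\<close> (up to a shift of the exponent) by
  \<open>P\<^sub>v(t) = \<Sum>\<^sub>k S\<^sub>v(k) k! (t choose k)\<close>, and binomial inversion recovers
  \<open>k! S\<^sub>v(k) = \<Sum>\<^sub>l (-1)\<^sup>l (k choose l) P\<^sub>v(k - l)\<close>. The same inversion shows that the coefficients
  of a normal ordering are unique.

  The shift from \<open>k\<close> to \<open>k + b\<close> comes from passing to the Dyck word \<open>v = x\<^sup>a w D\<^sup>b\<close>: multiplying the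
  normal ordering of \<open>w\<close> by \<open>x\<^sup>a\<close> on the left changes only the prefactor, and multiplying it by
  \<open>D\<^sup>b\<close> on the right turns \<open>x\<^sup>k D\<^sup>k\<close> into \<open>x\<^sup>k D\<^bsup>k+b\<^esup>\<close>, so \<open>S\<^sub>v(k + b) = S\<^sub>w(k)\<close>.

  It remains to see that \<open>P\<^sub>v(t) = \<Prod>\<^sub>i (t - a\<^sub>i)\<close> for a Dyck word \<open>v\<close>. Applied to \<open>x\<^sup>t\<close>, a letter \<open>D\<close>
  that steps down to height \<open>h\<close> meets a power of \<open>x\<close> with exponent \<open>t - h\<close>, because the rest of the
  word leads from height \<open>h\<close> to \<open>0\<close>; so it contributes the factor \<open>t - h\<close>. In a Dyck word the steps
  from \<open>h + 1\<close> down to \<open>h\<close> are as many as the steps from \<open>h\<close> up to \<open>h + 1\<close>, and the latter are the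
  letters \<open>x\<close> of height \<open>h\<close>. Instead of matching the letters, \<open>prod_x_heights\<close> compares the two
  products for every prefix, where they differ by one factor \<open>t - j\<close> for each level \<open>j\<close> that is still
  to be descended.
\<close>

section \<open>Binomial inversion\<close>

text \<open>
  Choosing \<open>l\<close> elements and then \<open>j\<close> of the others amounts to choosing the \<open>j\<close> first, so the sum is
  \<open>k choose j\<close> times the alternating sum of row \<open>k - j\<close> of the Pascal triangle.
\<close>
lemma choose_choose_alternating_sum:
  "(\<Sum>l\<le>k. (-1) ^ l * of_nat (k choose l) * of_nat ((k - l) choose j)) =
     (if j = k then 1 else (0 :: 'a::comm_ring_1))"
proof (cases "j \<le> k")
  case True
  have trinomial: "(k choose l) * ((k - l) choose j) = (k choose j) * ((k - j) choose l)"
    if "l \<le> k" for l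
  proof (cases "l \<le> k - j")
    case True
    then have "(k choose l) * ((k - l) choose j) = (k choose (k - l)) * ((k - l) choose j)"
      using that binomial_symmetric[of l k] by simp
    also have "\<dots> = (k choose j) * ((k - j) choose (k - l - j))"
      using True \<open>j \<le> k\<close> by (intro choose_mult) auto
    also have "(k - j) choose (k - l - j) = (k - j) choose l"
      using True binomial_symmetric[of l "k - j"] by (simp add: add.commute)
    finally show ?thesis .
  next
    case False
    then show ?thesis using that by (simp add: binomial_eq_0)
  qed
  have "(\<Sum>l\<le>k. (-1) ^ l * of_nat (k choose l) * of_nat ((k - l) choose j)) =
      (\<Sum>l\<le>k. of_nat (k choose j) * ((-1) ^ l * of_nat ((k - j) choose l)) :: 'a)"
  proof (rule sum.cong)
    fix l
    assume "l \<in> {..k}"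
    then have "of_nat (k choose l) * of_nat ((k - l) choose j) =
        (of_nat (k choose j) * of_nat ((k - j) choose l) :: 'a)"
      using trinomial[of l] by (simp flip: of_nat_mult)
    then show "(-1) ^ l * of_nat (k choose l) * of_nat ((k - l) choose j) =
        of_nat (k choose j) * ((-1) ^ l * of_nat ((k - j) choose l) :: 'a)"
      by (simp add: mult.assoc mult.left_commute)
  qed simp
  also have "\<dots> = of_nat (k choose j) * (\<Sum>l\<le>k. (-1) ^ l * of_nat ((k - j) choose l))"
    by (simp add: sum_distrib_left)
  also have "(\<Sum>l\<le>k. (-1) ^ l * of_nat ((k - j) choose l) :: 'a) =
      (\<Sum>l\<le>k - j. (-1) ^ l * of_nat ((k - j) choose l))"
    by (rule sum.mono_neutral_right) (auto simp: binomial_eq_0)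
  also have "\<dots> = (if j = k then 1 else 0)"
    using choose_alternating_sum[of "k - j", where 'a = 'a] True by auto
  finally show ?thesis by auto
next
  case False
  then show ?thesis by (auto simp: binomial_eq_0 intro!: sum.neutral)
qed

text \<open>
  A finite support set \<open>A\<close> independent of \<open>k\<close>, in place of the usual range \<open>j \<le> k\<close>, lets the
  inversion apply directly to the coefficients of a normal ordering.
\<close>
lemma binomial_inversion:
  fixes s :: "nat \<Rightarrow> 'a::comm_ring_1"
  assumes "finite A" and "\<And>j. j \<notin> A \<Longrightarrow> s j = 0"
  shows "(\<Sum>l\<le>k. (-1) ^ l * of_nat (k choose l) * (\<Sum>j\<in>A. s j * of_nat ((k - l) choose j))) = s k"
proof -
  have "(\<Sum>l\<le>k. (-1) ^ l * of_nat (k choose l) * (\<Sum>j\<in>A. s j * of_nat ((k - l) choose j))) =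
      (\<Sum>l\<le>k. \<Sum>j\<in>A. s j * ((-1) ^ l * of_nat (k choose l) * of_nat ((k - l) choose j)))"
    by (simp add: sum_distrib_left mult_ac)
  also have "\<dots> = (\<Sum>j\<in>A. s j * (\<Sum>l\<le>k. (-1) ^ l * of_nat (k choose l) * of_nat ((k - l) choose j)))"
    by (subst sum.swap) (simp add: sum_distrib_left)
  also have "\<dots> = (\<Sum>j\<in>A. if j = k then s j else 0)"
    unfolding choose_choose_alternating_sum by (rule sum.cong) auto
  also have "\<dots> = s k"
    using assms by (simp add: sum.delta)
  finally show ?thesis .
qed

section \<open>The coefficients of the normal ordering\<close>

lemma num_simps [simp]:
  "num_x [] = 0" "num_d [] = 0"
  "num_x (LX # w) = Suc (num_x w)" "num_d (LX # w) = num_d w"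
  "num_x (LD # w) = num_x w" "num_d (LD # w) = Suc (num_d w)"
  "num_x (u @ v) = num_x u + num_x v" "num_d (u @ v) = num_d u + num_d v"
  "num_x (replicate n LX) = n" "num_d (replicate n LX) = 0"
  "num_x (replicate n LD) = 0" "num_d (replicate n LD) = n"
proof -
  show "num_x (replicate n LX) = n" "num_d (replicate n LX) = 0"
    "num_x (replicate n LD) = 0" "num_d (replicate n LD) = n"
    by (induction n) (auto simp: num_x_def num_d_def)
qed (auto simp: num_x_def num_d_def)

definition excess :: "word \<Rightarrow> int" where
  "excess w = int (num_x w) - int (num_d w)"

lemma excess_simps [simp]:
  "excess [] = 0" "excess (LX # w) = excess w + 1" "excess (LD # w) = excess w - 1"
  "excess (u @ v) = excess u + excess v"
  "excess (replicate n LX) = int n" "excess (replicate n LD) = - int n"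
  by (auto simp: excess_def)

text \<open>
  With \<open>e\<close> the excess of \<open>w\<close>, the product rule gives
  \<open>D x\<^bsup>e+k\<^esup> D\<^sup>k = (e + k) x\<^bsup>e-1+k\<^esup> D\<^sup>k + x\<^bsup>e-1+(k+1)\<^esup> D\<^bsup>k+1\<^esup>\<close>,
  whose two summands are collected by powers of \<open>D\<close> in the last equation.
\<close>
fun ordered_coeff :: "word \<Rightarrow> nat \<Rightarrow> int" where
  "ordered_coeff [] k = (if k = 0 then 1 else 0)"
| "ordered_coeff (LX # w) k = ordered_coeff w k"
| "ordered_coeff (LD # w) k =
     (excess w + int k) * ordered_coeff w k + (if k = 0 then 0 else ordered_coeff w (k - 1))"

lemma ordered_coeff_eq_0: "num_d w < k \<Longrightarrow> ordered_coeff w k = 0"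
  by (induction w k rule: ordered_coeff.induct) auto

lemma le_num_d_of_ordered_coeff: "ordered_coeff w k \<noteq> 0 \<Longrightarrow> k \<le> num_d w"
  using ordered_coeff_eq_0 not_le by blast

text \<open>
  The recursion for a leading \<open>LD\<close>, summed against an arbitrary sequence \<open>g\<close>. With \<open>e\<close> the
  excess of \<open>w\<close>, it is used with \<open>g k = x\<^bsup>e-1+k\<^esup> D\<^sup>k f\<close> to establish the normal ordering, and
  with the falling factorials of \<open>t\<close> to compute the action on \<open>x\<^sup>t\<close>.
\<close>
lemma sum_ordered_coeff_LD:
  fixes g :: "nat \<Rightarrow> real"
  assumes "num_d w \<le> M"
  shows "(\<Sum>k\<le>Suc M. of_int (ordered_coeff (LD # w) k) * g k) =
    (\<Sum>k\<le>M. of_int (ordered_coeff w k) * (of_int (excess w + int k) * g k + g (Suc k)))"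
proof -
  let ?S = "\<lambda>k. real_of_int (ordered_coeff w k)"
  have "(\<Sum>k\<le>Suc M. of_int (ordered_coeff (LD # w) k) * g k) =
      (\<Sum>k\<le>Suc M. of_int (excess w + int k) * ?S k * g k) +
      (\<Sum>k\<le>Suc M. (if k = 0 then 0 else ?S (k - 1)) * g k)"
    by (subst sum.distrib[symmetric]) (rule sum.cong, auto simp: algebra_simps)
  also have "(\<Sum>k\<le>Suc M. of_int (excess w + int k) * ?S k * g k) =
      (\<Sum>k\<le>M. of_int (excess w + int k) * ?S k * g k)"
    using assms by (simp add: ordered_coeff_eq_0)
  also have "(\<Sum>k\<le>Suc M. (if k = 0 then 0 else ?S (k - 1)) * g k) = (\<Sum>k\<le>M. ?S k * g (Suc k))"
    by (subst sum.atMost_Suc_shift) simp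
  finally show ?thesis
    by (simp add: sum.distrib algebra_simps)
qed

text \<open>
  The power of \<open>x\<close> is kept inside the sum so that differentiation acts on each summand separately.
\<close>
lemma word_op_expansion:
  assumes "smooth_pos f" and "x > 0"
  shows "word_op w f x =
    (\<Sum>k\<le>num_d w. of_int (ordered_coeff w k) * (x powi (excess w + int k) * (deriv ^^ k) f x))"
  using assms(2)
proof (induction w arbitrary: x)
  case Nil
  then show ?case by simp
next
  case (Cons c w)
  show ?case
  proof (cases c)
    case LX
    have "x powi (excess w + 1 + int k) = x * x powi (excess w + int k)" for k
      using Cons.prems power_int_add_1'[of x "excess w + int k"] by (simp add: algebra_simps)
    then show ?thesis
      using LX Cons by (simp add: sum_distrib_left mult_ac)
  next
    case LD
    let ?F = "\<lambda>y. \<Sum>k\<le>num_d w.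
      of_int (ordered_coeff w k) * (y powi (excess w + int k) * (deriv ^^ k) f y)"
    let ?g = "\<lambda>k. x powi (excess w - 1 + int k) * (deriv ^^ k) f x"
    have "\<forall>\<^sub>F y in nhds x. y > 0"
      using Cons.prems by (intro eventually_nhds_in_open[of "{0<..}", simplified]) auto
    then have "\<forall>\<^sub>F y in nhds x. word_op w f y = ?F y"
      by eventually_elim (rule Cons.IH)
    then have "word_op (LD # w) f x = deriv ?F x"
      by (simp add: deriv_cong_ev)
    also have "\<dots> = (\<Sum>k\<le>num_d w. of_int (ordered_coeff w k) *
        (of_int (excess w + int k) * ?g k + ?g (Suc k)))"
    proof (rule DERIV_imp_deriv)
      have D: "((deriv ^^ k) f has_real_derivative (deriv ^^ Suc k) f x) (at x)" for k
        using assms(1) Cons.prems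
        by (simp add: smooth_pos_def DERIV_deriv_iff_field_differentiable)
      have "((\<lambda>y. y powi (excess w + int k) * (deriv ^^ k) f y) has_real_derivative
          of_int (excess w + int k) * ?g k + ?g (Suc k)) (at x)" for k
        using Cons.prems
        by (auto intro!: derivative_eq_intros D simp: algebra_simps)
      then show "(?F has_real_derivative (\<Sum>k\<le>num_d w. of_int (ordered_coeff w k) *
          (of_int (excess w + int k) * ?g k + ?g (Suc k)))) (at x)"
        by (intro DERIV_sum DERIV_cmult)
    qed
    also have "\<dots> = (\<Sum>k\<le>Suc (num_d w). of_int (ordered_coeff (LD # w) k) * ?g k)"
      by (rule sum_ordered_coeff_LD[symmetric]) simp
    finally show ?thesis
      using LD by simp
  qed
qed

lemma finite_support_ordered_coeff: "finite {k. ordered_coeff w k \<noteq> 0}"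
  by (rule finite_subset[of _ "{..num_d w}"]) (auto dest: le_num_d_of_ordered_coeff)

lemma normal_ordering_ordered_coeff: "normal_ordering w (ordered_coeff w)"
  unfolding normal_ordering_def
proof (intro conjI allI impI)
  show "finite {k. ordered_coeff w k \<noteq> 0}"
    by (rule finite_support_ordered_coeff)
next
  fix f :: "real \<Rightarrow> real" and x :: real
  assume "smooth_pos f" and "x > 0"
  have "word_op w f x = (\<Sum>k\<le>num_d w. of_int (ordered_coeff w k) *
      (x powi (excess w + int k) * (deriv ^^ k) f x))"
    by (rule word_op_expansion) fact+
  also have "\<dots> = (\<Sum>k | ordered_coeff w k \<noteq> 0. of_int (ordered_coeff w k) *
      (x powi (excess w + int k) * (deriv ^^ k) f x))"
    by (rule sum.mono_neutral_right) (auto dest: le_num_d_of_ordered_coeff)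
  also have "\<dots> = x powi excess w *
      (\<Sum>k | ordered_coeff w k \<noteq> 0. of_int (ordered_coeff w k) * x ^ k * (deriv ^^ k) f x)"
    using \<open>x > 0\<close> by (simp add: sum_distrib_left power_int_add mult_ac)
  finally show "word_op w f x = x powi (int (num_x w) - int (num_d w)) *
      (\<Sum>k | ordered_coeff w k \<noteq> 0. of_int (ordered_coeff w k) * x ^ k * (deriv ^^ k) f x)"
    by (simp add: excess_def)
qed

lemma higher_deriv_monomial:
  "(deriv ^^ k) (\<lambda>x::real. x ^ t) = (\<lambda>x. fact k * real (t choose k) * x ^ (t - k))"
proof (induction k)
  case 0
  then show ?case by simp
next
  case (Suc k)
  have absorb: "real (Suc k) * real (t choose Suc k) = real (t - k) * real (t choose k)"
    by (simp only: binomial_absorption binomial_absorb_comp flip: of_nat_mult)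
  have "deriv (\<lambda>x. fact k * real (t choose k) * x ^ (t - k)) y =
      fact (Suc k) * real (t choose Suc k) * y ^ (t - Suc k)" for y :: real
  proof (rule DERIV_imp_deriv)
    have "fact (Suc k) * real (t choose Suc k) = fact k * (real (t - k) * real (t choose k))"
      by (simp only: absorb[symmetric] fact_Suc) (simp add: algebra_simps)
    then show "((\<lambda>x. fact k * real (t choose k) * x ^ (t - k)) has_real_derivative
        fact (Suc k) * real (t choose Suc k) * y ^ (t - Suc k)) (at y)"
      by (auto intro!: derivative_eq_intros)
  qed
  then show ?case using Suc by auto
qed

lemma smooth_pos_monomial: "smooth_pos (\<lambda>x. x ^ t)"
  unfolding smooth_pos_def higher_deriv_monomial
  by (auto simp: field_differentiable_def intro!: exI derivative_eq_intros)

text \<open>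
  Evaluating \<open>w x\<^sup>t\<close> at \<open>1\<close> for \<open>t = 0, 1, 2, \<dots>\<close> yields the sums \<open>\<Sum>\<^sub>j S(j) j! (t choose j)\<close>, from
  which binomial inversion recovers each \<open>S(k)\<close>.
\<close>
lemma normal_ordering_unique:
  assumes "normal_ordering w S" and "normal_ordering w T"
  shows "S = T"
proof
  fix k
  have inv: "real_of_int (R k) * fact k =
      (\<Sum>l\<le>k. (-1) ^ l * real (k choose l) * word_op w (\<lambda>x. x ^ (k - l)) 1)"
    if R: "normal_ordering w R" for R
  proof -
    have op: "word_op w (\<lambda>x. x ^ t) 1 =
        (\<Sum>j | R j \<noteq> 0. real_of_int (R j) * fact j * real (t choose j))" for t
    proof -
      have "word_op w (\<lambda>x. x ^ t) 1 = 1 powi (int (num_x w) - int (num_d w)) *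
          (\<Sum>j | R j \<noteq> 0. real_of_int (R j) * 1 ^ j * (deriv ^^ j) (\<lambda>x. x ^ t) 1)"
        using R[unfolded normal_ordering_def, THEN conjunct2, rule_format,
            OF smooth_pos_monomial zero_less_one] .
      then show ?thesis by (simp add: higher_deriv_monomial mult.assoc)
    qed
    show ?thesis
      unfolding op using R
      by (intro binomial_inversion[symmetric]) (auto simp: normal_ordering_def)
  qed
  have "real_of_int (S k) * fact k = real_of_int (T k) * fact k"
    unfolding inv[OF assms(1)] inv[OF assms(2)] ..
  then show "S k = T k" by simp
qed

lemma word_stirling_eq_ordered_coeff: "word_stirling w = ordered_coeff w"
  unfolding word_stirling_def
  using normal_ordering_ordered_coeff normal_ordering_unique by (intro the_equality) auto

section \<open>Words as operators on monomials\<close>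

text \<open>
  The factor \<open>c\<close> in \<open>w x\<^sup>t = c x\<^bsup>t+e\<^esup>\<close>, where \<open>e\<close> is the excess of \<open>w\<close>: each \<open>LD\<close> contributes the
  exponent of the power of \<open>x\<close> that it differentiates.
\<close>
fun monomial_factor :: "word \<Rightarrow> real \<Rightarrow> real" where
  "monomial_factor [] t = 1"
| "monomial_factor (LX # w) t = monomial_factor w t"
| "monomial_factor (LD # w) t = (t + of_int (excess w)) * monomial_factor w t"

text \<open>
  The normal ordering applied to \<open>x\<^sup>t\<close> and compared with the direct evaluation letter by letter.
  The induction step is \<open>(e + k) + (t - k) = t + e\<close>, where the factor \<open>t - k\<close> turns the \<open>k\<close>-th falling
  factorial of \<open>t\<close> into the next one.
\<close>
lemma sum_ordered_coeff:
  "num_d w \<le> N \<Longrightarrow>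
    (\<Sum>k\<le>N. of_int (ordered_coeff w k) * (fact k * (t gchoose k))) = monomial_factor w t"
proof (induction w arbitrary: N)
  case Nil
  have "(\<Sum>k\<le>N. of_int (ordered_coeff [] k) * (fact k * (t gchoose k))) =
      (\<Sum>k\<le>N. if k = 0 then 1 else 0)"
    by (rule sum.cong) auto
  then show ?case by simp
next
  case (Cons c w)
  show ?case
  proof (cases c)
    case LX
    then show ?thesis using Cons by simp
  next
    case LD
    with Cons.prems obtain M where N: "N = Suc M" and M: "num_d w \<le> M"
      by (cases N) auto
    have absorb: "of_int (excess w + int k) * (fact k * (t gchoose k)) + fact (Suc k) * (t gchoose Suc k) =
        (t + of_int (excess w)) * (fact k * (t gchoose k))" for k
    proof -
      have "fact (Suc k) * (t gchoose Suc k) = fact k * (of_nat (Suc k) * (t gchoose Suc k))"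
        by (simp add: algebra_simps)
      also have "of_nat (Suc k) * (t gchoose Suc k) = t * (t gchoose k) - of_nat k * (t gchoose k)"
        using gbinomial_mult_1[of t k] by simp
      finally show ?thesis by (simp only: of_int_add of_int_of_nat_eq) (simp add: algebra_simps)
    qed
    have "(\<Sum>k\<le>N. of_int (ordered_coeff (LD # w) k) * (fact k * (t gchoose k))) =
        (\<Sum>k\<le>M. of_int (ordered_coeff w k) * ((t + of_int (excess w)) * (fact k * (t gchoose k))))"
      unfolding N sum_ordered_coeff_LD[OF M] absorb ..
    also have "\<dots> = (t + of_int (excess w)) *
        (\<Sum>k\<le>M. of_int (ordered_coeff w k) * (fact k * (t gchoose k)))"
      by (simp add: sum_distrib_left mult_ac)
    finally show ?thesis
      using LD Cons.IH[OF M] by simp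
  qed
qed

lemma ordered_coeff_inversion:
  "real_of_int (ordered_coeff w k) =
     1 / fact k * (\<Sum>l\<le>k. (-1) ^ l * real (k choose l) * monomial_factor w (real (k - l)))"
proof -
  have "monomial_factor w (real n) =
      (\<Sum>j\<le>num_d w. of_int (ordered_coeff w j) * fact j * real (n choose j))" for n
    using sum_ordered_coeff[OF order_refl, of w "real n"]
    by (simp add: binomial_gbinomial mult.assoc)
  then have "(\<Sum>l\<le>k. (-1) ^ l * real (k choose l) * monomial_factor w (real (k - l))) =
      of_int (ordered_coeff w k) * fact k"
    by (simp only:) (intro binomial_inversion, auto simp: ordered_coeff_eq_0)
  then show ?thesis by simp
qed

lemma monomial_factor_append:
  "monomial_factor (u @ v) t = monomial_factor u (t + of_int (excess v)) * monomial_factor v t"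
  by (induction u t rule: monomial_factor.induct) (auto simp: algebra_simps)

text \<open>
  Multiplication by \<open>D\<^sup>b\<close> on the right turns \<open>x\<^bsup>e+k\<^esup> D\<^sup>k\<close> into \<open>x\<^bsup>(e-b)+(k+b)\<^esup> D\<^bsup>k+b\<^esup>\<close>: the excess
  drops by \<open>b\<close> and the index grows by \<open>b\<close>, so that the factor \<open>e + k\<close> of the recursion is unchanged.
\<close>
lemma ordered_coeff_append_LDs:
  "ordered_coeff (w @ replicate b LD) k = (if k < b then 0 else ordered_coeff w (k - b))"
proof (induction w k rule: ordered_coeff.induct)
  case (1 k)
  show ?case
    by (induction b arbitrary: k) auto
next
  case (3 w k)
  then show ?case by (auto simp: of_nat_diff algebra_simps)
qed simp

lemma ordered_coeff_prepend_LXs: "ordered_coeff (replicate a LX @ w) k = ordered_coeff w k"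
  by (induction a) auto

section \<open>Heights in Dyck words\<close>

lemma length_x_positions: "length (filter (\<lambda>p. v ! p = LX) [0..<length v]) = num_x v"
proof (induction v rule: rev_induct)
  case (snoc c v)
  have "filter (\<lambda>p. (v @ [c]) ! p = LX) [0..<length v] = filter (\<lambda>p. v ! p = LX) [0..<length v]"
    by (rule filter_cong) (auto simp: nth_append)
  with snoc show ?case by (cases c) auto
qed simp

lemma x_position_snoc:
  assumes "1 \<le> i" and "i \<le> num_x v"
  shows "x_position (v @ [c]) i = x_position v i" and "x_position v i < length v"
proof -
  let ?ps = "filter (\<lambda>p. v ! p = LX) [0..<length v]"
  have eq: "filter (\<lambda>p. (v @ [c]) ! p = LX) [0..<length v] = ?ps"
    by (rule filter_cong) (auto simp: nth_append)
  have i: "i - 1 < length ?ps"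
    using assms by (simp add: length_x_positions)
  with eq show "x_position (v @ [c]) i = x_position v i"
    by (simp add: x_position_def nth_append)
  from nth_mem[OF i] show "x_position v i < length v"
    by (simp add: x_position_def)
qed

lemma x_height_snoc:
  assumes "1 \<le> i" and "i \<le> num_x v"
  shows "x_height (v @ [c]) i = x_height v i"
  using x_position_snoc[OF assms] by (simp add: x_height_def)

lemma x_height_last: "x_height (v @ [LX]) (Suc (num_x v)) = excess v"
proof -
  have "filter (\<lambda>p. (v @ [LX]) ! p = LX) [0..<length v] = filter (\<lambda>p. v ! p = LX) [0..<length v]"
    by (rule filter_cong) (auto simp: nth_append)
  then have "x_position (v @ [LX]) (Suc (num_x v)) = length v"
    by (simp add: x_position_def nth_append length_x_positions)
  then show ?thesis by (simp add: x_height_def excess_def)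
qed

text \<open>
  The last product is a potential that depends only on the current height \<open>h\<close>. Appending an \<open>x\<close>
  puts the factor \<open>t - h\<close> into the product over the heights and into the potential. Appending a \<open>D\<close>
  moves the factor \<open>t - (h - 1)\<close> from the potential to the monomial factor. The argument
  \<open>t - h\<close> of the monomial factor ensures that a letter ending at height \<open>h'\<close> always acts on
  \<open>x\<^bsup>t-h'\<^esup>\<close>, so the factors of earlier letters stay the same when the word is
  extended. For a Dyck word \<open>h = 0\<close> and the potential is \<open>1\<close>.
\<close>
lemma prod_x_heights:
  assumes "prefix_dominant v"
  shows "(\<Prod>i = 1..num_x v. t - of_int (x_height v i)) =
    monomial_factor v (t - of_int (excess v)) * (\<Prod>j<nat (excess v). t - real j)"
  using assms
proof (induction v rule: rev_induct)
  case Nil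
  then show ?case by simp
next
  case (snoc c v)
  have dom: "prefix_dominant v"
    using snoc.prems by (auto simp: prefix_dominant_def)
  then have nonneg: "excess v \<ge> 0" "excess (v @ [c]) \<ge> 0"
    using snoc.prems by (auto simp: prefix_dominant_def excess_def)
  have old: "(\<Prod>i = 1..num_x v. t - of_int (x_height (v @ [c]) i)) =
      (\<Prod>i = 1..num_x v. t - of_int (x_height v i))"
    by (rule prod.cong) (auto simp: x_height_snoc)
  show ?case
  proof (cases c)
    case LX
    have "nat (excess v + 1) = Suc (nat (excess v))"
      using nonneg by (simp add: nat_add_distrib)
    then show ?thesis
      using LX nonneg old snoc.IH[OF dom] x_height_last[of v]
      by (simp add: monomial_factor_append mult_ac)
  next
    case LD
    then have "nat (excess v) = Suc (nat (excess v - 1))"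
      and "real (nat (excess v - 1)) = of_int (excess v) - 1"
      using nonneg by auto
    then show ?thesis
      using LD old snoc.IH[OF dom] by (simp add: monomial_factor_append mult_ac algebra_simps)
  qed
qed

lemma num_d_le_of_prefix: "prefix u v \<Longrightarrow> num_d u \<le> num_d v"
  by (auto simp: prefix_def)

text \<open>
  The least admissible \<open>a\<close> exists because prepending as many \<open>x\<close> as there are \<open>D\<close> in \<open>w\<close> suffices.
\<close>
lemma prefix_dominant_dyck_a: "prefix_dominant (replicate (dyck_a w) LX @ w)"
  unfolding dyck_a_def
proof (rule LeastI)
  show "prefix_dominant (replicate (num_d w) LX @ w)"
    unfolding prefix_dominant_def
  proof (intro allI impI)
    fix u
    assume "prefix u (replicate (num_d w) LX @ w)"
    then consider "prefix u (replicate (num_d w) LX)"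
      | us where "u = replicate (num_d w) LX @ us" and "prefix us w"
      by (auto simp: prefix_append)
    then show "num_d u \<le> num_x u"
    proof cases
      case 1
      from num_d_le_of_prefix[OF this] show ?thesis by simp
    next
      case 2
      from num_d_le_of_prefix[OF this(2)] show ?thesis using 2(1) by simp
    qed
  qed
qed

lemma dyck_word_assoc_dyck: "dyck_word (assoc_dyck w)"
proof -
  let ?u = "replicate (dyck_a w) LX @ w"
  have le: "num_d ?u \<le> num_x ?u"
    using prefix_dominant_dyck_a[of w] unfolding prefix_dominant_def by blast
  have "num_d p \<le> num_x p" if "prefix p (?u @ replicate (num_x ?u - num_d ?u) LD)" for p
  proof (cases "prefix p ?u")
    case True
    then show ?thesis
      using prefix_dominant_dyck_a[of w] unfolding prefix_dominant_def by blast
  next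
    case False
    with that obtain us where "p = ?u @ us" and "prefix us (replicate (num_x ?u - num_d ?u) LD)"
      by (auto simp: prefix_append)
    moreover from num_d_le_of_prefix[OF this(2)] have "num_d us \<le> num_x ?u - num_d ?u"
      by simp
    ultimately show ?thesis using le by simp
  qed
  then have "dyck_word (replicate (dyck_a w) LX @ w @ replicate (num_x ?u - num_d ?u) LD)"
    using le unfolding dyck_word_def prefix_dominant_def by auto
  then have "dyck_word (replicate (dyck_a w) LX @ w @ replicate (dyck_b w) LD)"
    unfolding dyck_b_def by (rule theI) (auto simp: dyck_word_def)
  then show ?thesis by (simp add: assoc_dyck_def)
qed

section \<open>The explicit formula\<close>

theorem theorem2p7:
  fixes w :: word and m a b k :: nat
  assumes "m = num_x w" and "a = dyck_a w" and "b = dyck_b w"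
  shows "real_of_int (word_stirling w k) =
    1 / fact (k + b) *
      (\<Sum>l = 0..k + b. (- 1) ^ l * real ((k + b) choose l) *
        (\<Prod>i = 1..m + a. real_of_int (int k + int b - int l - x_height (assoc_dyck w) i)))"
proof -
  let ?v = "assoc_dyck w"
  have v: "?v = replicate a LX @ w @ replicate b LD"
    using assms by (simp add: assoc_dyck_def)
  have dominant: "prefix_dominant ?v" and "excess ?v = 0"
    using dyck_word_assoc_dyck[of w] by (auto simp: dyck_word_def excess_def)
  then have factor: "monomial_factor ?v t = (\<Prod>i = 1..m + a. t - of_int (x_height ?v i))" for t
    using prod_x_heights[of ?v t] assms(1) v by (simp add: add.commute)
  have "word_stirling w k = ordered_coeff ?v (k + b)"
    by (simp add: v word_stirling_eq_ordered_coeff ordered_coeff_prepend_LXs ordered_coeff_append_LDs)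
  also have "real_of_int \<dots> = 1 / fact (k + b) * (\<Sum>l\<le>k + b. (-1) ^ l * real ((k + b) choose l) *
      monomial_factor ?v (real (k + b - l)))"
    by (rule ordered_coeff_inversion)
  also have "\<dots> = 1 / fact (k + b) *
      (\<Sum>l = 0..k + b. (- 1) ^ l * real ((k + b) choose l) *
        (\<Prod>i = 1..m + a. real_of_int (int k + int b - int l - x_height ?v i)))"
    by (simp add: factor atLeast0AtMost of_nat_diff)
  finally show ?thesis .
qed

end
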